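(* A jointly mono span $X_1\xleftarrow{\pi_1}B\xrightarrow{\pi_2}X_2$ between $T$-coalgebras $(X_1,\gamma_1)$ and $(X_2,\gamma_2)$ is a $\rho$-bisimulation if and only if there exists a morphism $\delta\colon B\to T^\rho B$ in $\mathcal C$ such that $T^\rho\pi_i\circ\delta=\gamma_i\circ\pi_i$ for $i=1,2$.
   Context: $P\colon\mathcal C\to\mathcal A$, $S\colon\mathcal A\to\mathcal C$ are contravariant functors forming a dual adjunction (natural bijection $\mathcal C(X,SA)\cong\mathcal A(A,PX)$) with units $\eta^{\mathcal C}\colon\mathrm{Id}_{\mathcal C}\to SP$, $\eta^{\mathcal A}\colon\mathrm{Id}_{\mathcal A}\to PS$. $T\colon\mathcal C\to\mathcal C$ is an endofunctor; a $T$-coalgebra is $(X,\gamma)$ with $\gamma\colon X\to TX$. $(L,\rho)$ is a logic: $L\colon\mathcal A\to\mathcal A$, $\rho\colon LP\to PT$ natural; complex algebra $\gamma^*=P\gamma\circ\rho_X$. Standing assumptions: $\mathcal C$ is finitely complete, well-powered, with an $(\mathcal E,\mathrm{Mono})$-factorisation system; $\mathcal A$ has pullbacks or $\mathcal C$ has pushouts. A span $X_1\xleftarrow{\pi_1}B\xrightarrow{\pi_2}X_2$ is jointly mono if $\pi_1h=\pi_1h'$ and $\pi_2h=\pi_2h'$ imply $h=h'$; its dual span $(\bar B,\bar\pi_1,\bar\pi_2)$ is the pullback in $\mathcal A$ of $PX_1\xrightarrow{P\pi_1}PB\xleftarrow{P\pi_2}PX_2$; it is a $\rho$-bisimulation between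 $(X_1,\gamma_1),(X_2,\gamma_2)$ if $P\pi_1\circ\gamma_1^*\circ L\bar\pi_1=P\pi_2\circ\gamma_2^*\circ L\bar\pi_2$. Relation lifting: for $i=1,2$ let $\sigma_i=SL\bar\pi_i\circ S\rho_{X_i}\circ\eta^{\mathcal C}_{TX_i}\colon TX_i\to SL\bar B$, and let $(T^\rho B,T^\rho\pi_1,T^\rho\pi_2)$, with $T^\rho\pi_i\colon T^\rho B\to TX_i$, be the pullback in $\mathcal C$ of $TX_1\xrightarrow{\sigma_1}SL\bar B\xleftarrow{\sigma_2}TX_2$. *)

theory Defs
  imports Main "HOL-Library.Equipollence"
begin

section \<open>Categories\<close>

record ('o, 'm) cat =
  Obj :: "'o set"
  Arr :: "'m set"
  Dom :: "'m \<Rightarrow> 'o"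
  Cod :: "'m \<Rightarrow> 'o"
  Ident :: "'o \<Rightarrow> 'm"
  Comp :: "'m \<Rightarrow> 'm \<Rightarrow> 'm" (infixr "\<cdot>\<index>" 70)

text \<open>Composition is in applicative order: \<open>g \<cdot>\<^bsub>C\<^esub> f\<close> means first \<open>f\<close>, then \<open>g\<close>.\<close>

definition hom :: "('o, 'm) cat \<Rightarrow> 'o \<Rightarrow> 'o \<Rightarrow> 'm set" where
  "hom C X Y = {f \<in> Arr C. Dom C f = X \<and> Cod C f = Y}"

locale category =
  fixes C :: "('o, 'm) cat" (structure)
  assumes Dom_in_Obj: "f \<in> Arr C \<Longrightarrow> Dom C f \<in> Obj C"
    and Cod_in_Obj: "f \<in> Arr C \<Longrightarrow> Cod C f \<in> Obj C"
    and Ident_in_hom: "X \<in> Obj C \<Longrightarrow> Ident C X \<in> hom C X X"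
    and Comp_in_hom: "\<lbrakk>f \<in> hom C X Y; g \<in> hom C Y Z\<rbrakk> \<Longrightarrow> g \<cdot> f \<in> hom C X Z"
    and Ident_left: "f \<in> hom C X Y \<Longrightarrow> Ident C Y \<cdot> f = f"
    and Ident_right: "f \<in> hom C X Y \<Longrightarrow> f \<cdot> Ident C X = f"
    and Comp_assoc: "\<lbrakk>f \<in> hom C W X; g \<in> hom C X Y; h \<in> hom C Y Z\<rbrakk>
        \<Longrightarrow> (h \<cdot> g) \<cdot> f = h \<cdot> (g \<cdot> f)"

definition opp :: "('o, 'm) cat \<Rightarrow> ('o, 'm) cat" where
  "opp C = \<lparr>Obj = Obj C, Arr = Arr C, Dom = Cod C, Cod = Dom C, Ident = Ident C,
            Comp = (\<lambda>g f. f \<cdot>\<^bsub>C\<^esub> g)\<rparr>"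

definition is_iso :: "('o, 'm) cat \<Rightarrow> 'm \<Rightarrow> bool" where
  "is_iso C f \<longleftrightarrow> f \<in> Arr C \<and>
     (\<exists>g \<in> hom C (Cod C f) (Dom C f).
        g \<cdot>\<^bsub>C\<^esub> f = Ident C (Dom C f) \<and> f \<cdot>\<^bsub>C\<^esub> g = Ident C (Cod C f))"

definition is_mono :: "('o, 'm) cat \<Rightarrow> 'm \<Rightarrow> bool" where
  "is_mono C f \<longleftrightarrow> f \<in> Arr C \<and>
     (\<forall>Z. \<forall>h \<in> hom C Z (Dom C f). \<forall>h' \<in> hom C Z (Dom C f). f \<cdot>\<^bsub>C\<^esub> h = f \<cdot>\<^bsub>C\<^esub> h' \<longrightarrow> h = h')"

definition jointly_mono :: "('o, 'm) cat \<Rightarrow> 'o \<Rightarrow> 'm \<Rightarrow> 'm \<Rightarrow> bool" where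
  "jointly_mono C B p1 p2 \<longleftrightarrow>
     (\<forall>Z. \<forall>h \<in> hom C Z B. \<forall>h' \<in> hom C Z B.
        p1 \<cdot>\<^bsub>C\<^esub> h = p1 \<cdot>\<^bsub>C\<^esub> h' \<and> p2 \<cdot>\<^bsub>C\<^esub> h = p2 \<cdot>\<^bsub>C\<^esub> h' \<longrightarrow> h = h')"


section \<open>Functors and natural transformations\<close>

record ('o, 'm, 'p, 'n) func =
  fobj :: "'o \<Rightarrow> 'p"
  farr :: "'m \<Rightarrow> 'n"

definition is_functor :: "('o, 'm) cat \<Rightarrow> ('p, 'n) cat \<Rightarrow> ('o, 'm, 'p, 'n) func \<Rightarrow> bool" where
  "is_functor C D F \<longleftrightarrow>
     (\<forall>X \<in> Obj C. fobj F X \<in> Obj D) \<and>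
     (\<forall>X Y. \<forall>f \<in> hom C X Y. farr F f \<in> hom D (fobj F X) (fobj F Y)) \<and>
     (\<forall>X \<in> Obj C. farr F (Ident C X) = Ident D (fobj F X)) \<and>
     (\<forall>X Y Z. \<forall>f \<in> hom C X Y. \<forall>g \<in> hom C Y Z.
        farr F (g \<cdot>\<^bsub>C\<^esub> f) = farr F g \<cdot>\<^bsub>D\<^esub> farr F f)"

definition is_contra_functor ::
    "('o, 'm) cat \<Rightarrow> ('p, 'n) cat \<Rightarrow> ('o, 'm, 'p, 'n) func \<Rightarrow> bool" where
  "is_contra_functor C D F \<longleftrightarrow> is_functor (opp C) D F"

definition func_comp ::
    "('p, 'n, 'q, 'k) func \<Rightarrow> ('o, 'm, 'p, 'n) func \<Rightarrow> ('o, 'm, 'q, 'k) func" where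
  "func_comp G F = \<lparr>fobj = fobj G \<circ> fobj F, farr = farr G \<circ> farr F\<rparr>"

definition is_nat_trans :: "('o, 'm) cat \<Rightarrow> ('p, 'n) cat \<Rightarrow> ('o, 'm, 'p, 'n) func
    \<Rightarrow> ('o, 'm, 'p, 'n) func \<Rightarrow> ('o \<Rightarrow> 'n) \<Rightarrow> bool" where
  "is_nat_trans C D F G \<tau> \<longleftrightarrow>
     (\<forall>X \<in> Obj C. \<tau> X \<in> hom D (fobj F X) (fobj G X)) \<and>
     (\<forall>X Y. \<forall>f \<in> hom C X Y. farr G f \<cdot>\<^bsub>D\<^esub> \<tau> X = \<tau> Y \<cdot>\<^bsub>D\<^esub> farr F f)"


section \<open>Limits\<close>

definition is_cone :: "('j, 'i) cat \<Rightarrow> ('o, 'm) cat \<Rightarrow> ('j, 'i, 'o, 'm) func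
    \<Rightarrow> 'o \<Rightarrow> ('j \<Rightarrow> 'm) \<Rightarrow> bool" where
  "is_cone J C D N c \<longleftrightarrow> N \<in> Obj C \<and>
     (\<forall>j \<in> Obj J. c j \<in> hom C N (fobj D j)) \<and>
     (\<forall>u \<in> Arr J. farr D u \<cdot>\<^bsub>C\<^esub> c (Dom J u) = c (Cod J u))"

definition is_limit :: "('j, 'i) cat \<Rightarrow> ('o, 'm) cat \<Rightarrow> ('j, 'i, 'o, 'm) func
    \<Rightarrow> 'o \<Rightarrow> ('j \<Rightarrow> 'm) \<Rightarrow> bool" where
  "is_limit J C D N c \<longleftrightarrow> is_cone J C D N c \<and>
     (\<forall>N' c'. is_cone J C D N' c' \<longrightarrow>
        (\<exists>!h. h \<in> hom C N' N \<and> (\<forall>j \<in> Obj J. c j \<cdot>\<^bsub>C\<^esub> h = c' j)))"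

text \<open>Every finite category is isomorphic to one whose objects and arrows are natural numbers,
  so it suffices to let the shape range over categories on that type.\<close>

definition finitely_complete :: "('o, 'm) cat \<Rightarrow> bool" where
  "finitely_complete C \<longleftrightarrow>
     (\<forall>(J :: (nat, nat) cat) D.
        category J \<and> finite (Obj J) \<and> finite (Arr J) \<and> is_functor J C D \<longrightarrow>
        (\<exists>N c. is_limit J C D N c))"

definition is_pullback :: "('o, 'm) cat \<Rightarrow> 'm \<Rightarrow> 'm \<Rightarrow> 'o \<Rightarrow> 'm \<Rightarrow> 'm \<Rightarrow> bool" where
  "is_pullback C f g Q p q \<longleftrightarrow>
     f \<in> Arr C \<and> g \<in> Arr C \<and> Cod C f = Cod C g \<and>
     p \<in> hom C Q (Dom C f) \<and> q \<in> hom C Q (Dom C g) \<and> f \<cdot>\<^bsub>C\<^esub> p = g \<cdot>\<^bsub>C\<^esub> q \<and>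
     (\<forall>Z. \<forall>u \<in> hom C Z (Dom C f). \<forall>v \<in> hom C Z (Dom C g).
        f \<cdot>\<^bsub>C\<^esub> u = g \<cdot>\<^bsub>C\<^esub> v \<longrightarrow> (\<exists>!h. h \<in> hom C Z Q \<and> p \<cdot>\<^bsub>C\<^esub> h = u \<and> q \<cdot>\<^bsub>C\<^esub> h = v))"

definition has_pullbacks :: "('o, 'm) cat \<Rightarrow> bool" where
  "has_pullbacks C \<longleftrightarrow>
     (\<forall>f \<in> Arr C. \<forall>g \<in> Arr C. Cod C f = Cod C g \<longrightarrow> (\<exists>Q p q. is_pullback C f g Q p q))"

definition has_pushouts :: "('o, 'm) cat \<Rightarrow> bool" where
  "has_pushouts C \<longleftrightarrow> has_pullbacks (opp C)"


section \<open>Well-poweredness and factorisation systems\<close>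

text \<open>The type \<open>'s\<close> plays the role of the universe of sets: a set is small if it has strictly
  smaller cardinality than \<open>'s\<close>. The category is well-powered if every object has, up to
  isomorphism, only a small set of subobjects.\<close>

definition well_powered :: "'s itself \<Rightarrow> ('o, 'm) cat \<Rightarrow> bool" where
  "well_powered (_ :: 's itself) C \<longleftrightarrow>
     (\<forall>X \<in> Obj C. \<exists>R. R \<subseteq> {m. is_mono C m \<and> Cod C m = X} \<and> R \<prec> (UNIV :: 's set) \<and>
        (\<forall>m. is_mono C m \<and> Cod C m = X \<longrightarrow>
           (\<exists>r \<in> R. \<exists>i \<in> hom C (Dom C m) (Dom C r). is_iso C i \<and> r \<cdot>\<^bsub>C\<^esub> i = m)))"

definition factorisation_system :: "('o, 'm) cat \<Rightarrow> 'm set \<Rightarrow> 'm set \<Rightarrow> bool" where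
  "factorisation_system C \<E> \<M> \<longleftrightarrow>
     \<E> \<subseteq> Arr C \<and> \<M> \<subseteq> Arr C \<and>
     (\<forall>e \<in> \<E>. \<forall>i. is_iso C i \<and> Dom C i = Cod C e \<longrightarrow> i \<cdot>\<^bsub>C\<^esub> e \<in> \<E>) \<and>
     (\<forall>m \<in> \<M>. \<forall>i. is_iso C i \<and> Cod C i = Dom C m \<longrightarrow> m \<cdot>\<^bsub>C\<^esub> i \<in> \<M>) \<and>
     (\<forall>f \<in> Arr C. \<exists>e \<in> \<E>. \<exists>m \<in> \<M>.
        Dom C e = Dom C f \<and> Cod C e = Dom C m \<and> Cod C m = Cod C f \<and> f = m \<cdot>\<^bsub>C\<^esub> e) \<and>
     (\<forall>e \<in> \<E>. \<forall>m \<in> \<M>. \<forall>f \<in> hom C (Dom C e) (Dom C m). \<forall>g \<in> hom C (Cod C e) (Cod C m).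
        g \<cdot>\<^bsub>C\<^esub> e = m \<cdot>\<^bsub>C\<^esub> f \<longrightarrow>
        (\<exists>!d. d \<in> hom C (Cod C e) (Dom C m) \<and> d \<cdot>\<^bsub>C\<^esub> e = f \<and> m \<cdot>\<^bsub>C\<^esub> d = g))"


section \<open>Dual adjunctions, coalgebras and logics\<close>

text \<open>\<open>\<phi> X A\<close> is the bijection from \<open>C(X, S A)\<close> to \<open>A(A, P X)\<close>, natural in both arguments.\<close>

definition dual_adjunction :: "('o, 'm) cat \<Rightarrow> ('p, 'n) cat \<Rightarrow> ('o, 'm, 'p, 'n) func
    \<Rightarrow> ('p, 'n, 'o, 'm) func \<Rightarrow> ('o \<Rightarrow> 'p \<Rightarrow> 'm \<Rightarrow> 'n) \<Rightarrow> bool" where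
  "dual_adjunction \<C> \<A> P S \<phi> \<longleftrightarrow>
     is_contra_functor \<C> \<A> P \<and> is_contra_functor \<A> \<C> S \<and>
     (\<forall>X \<in> Obj \<C>. \<forall>A \<in> Obj \<A>.
        bij_betw (\<phi> X A) (hom \<C> X (fobj S A)) (hom \<A> A (fobj P X))) \<and>
     (\<forall>X X'. \<forall>A \<in> Obj \<A>. \<forall>h \<in> hom \<C> X' X. \<forall>f \<in> hom \<C> X (fobj S A).
        \<phi> X' A (f \<cdot>\<^bsub>\<C>\<^esub> h) = farr P h \<cdot>\<^bsub>\<A>\<^esub> \<phi> X A f) \<and>
     (\<forall>X \<in> Obj \<C>. \<forall>A A'. \<forall>g \<in> hom \<A> A' A. \<forall>f \<in> hom \<C> X (fobj S A).
        \<phi> X A' (farr S g \<cdot>\<^bsub>\<C>\<^esub> f) = \<phi> X A f \<cdot>\<^bsub>\<A>\<^esub> g)"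

text \<open>The unit \<open>X \<rightarrow> S (P X)\<close> is the morphism corresponding to the identity of \<open>P X\<close>.\<close>

definition unit_C :: "('o, 'm) cat \<Rightarrow> ('p, 'n) cat \<Rightarrow> ('o, 'm, 'p, 'n) func
    \<Rightarrow> ('p, 'n, 'o, 'm) func \<Rightarrow> ('o \<Rightarrow> 'p \<Rightarrow> 'm \<Rightarrow> 'n) \<Rightarrow> 'o \<Rightarrow> 'm" where
  "unit_C \<C> \<A> P S \<phi> X =
     inv_into (hom \<C> X (fobj S (fobj P X))) (\<phi> X (fobj P X)) (Ident \<A> (fobj P X))"

definition is_coalgebra :: "('o, 'm) cat \<Rightarrow> ('o, 'm, 'o, 'm) func \<Rightarrow> 'o \<Rightarrow> 'm \<Rightarrow> bool" where
  "is_coalgebra \<C> T X \<gamma> \<longleftrightarrow> X \<in> Obj \<C> \<and> \<gamma> \<in> hom \<C> X (fobj T X)"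

text \<open>The natural transformation \<open>L P \<rightarrow> P T\<close> is one between functors from the opposite of
  \<open>\<C>\<close> to \<open>\<A>\<close>.\<close>

definition is_logic :: "('o, 'm) cat \<Rightarrow> ('p, 'n) cat \<Rightarrow> ('o, 'm, 'p, 'n) func
    \<Rightarrow> ('o, 'm, 'o, 'm) func \<Rightarrow> ('p, 'n, 'p, 'n) func \<Rightarrow> ('o \<Rightarrow> 'n) \<Rightarrow> bool" where
  "is_logic \<C> \<A> P T L \<rho> \<longleftrightarrow>
     is_functor \<A> \<A> L \<and> is_nat_trans (opp \<C>) \<A> (func_comp L P) (func_comp P T) \<rho>"

definition complex_algebra :: "('p, 'n) cat \<Rightarrow> ('o, 'm, 'p, 'n) func \<Rightarrow> ('o \<Rightarrow> 'n)
    \<Rightarrow> 'o \<Rightarrow> 'm \<Rightarrow> 'n" where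
  "complex_algebra \<A> P \<rho> X \<gamma> = farr P \<gamma> \<cdot>\<^bsub>\<A>\<^esub> \<rho> X"


section \<open>Bisimulations and relation lifting\<close>

definition is_dual_span :: "('p, 'n) cat \<Rightarrow> ('o, 'm, 'p, 'n) func \<Rightarrow> 'm \<Rightarrow> 'm
    \<Rightarrow> 'p \<Rightarrow> 'n \<Rightarrow> 'n \<Rightarrow> bool" where
  "is_dual_span \<A> P \<pi>1 \<pi>2 Bd \<pi>d1 \<pi>d2 \<longleftrightarrow>
     is_pullback \<A> (farr P \<pi>1) (farr P \<pi>2) Bd \<pi>d1 \<pi>d2"

text \<open>\<open>\<pi>d1\<close> and \<open>\<pi>d2\<close> are the legs of the dual span of \<open>(\<pi>1, \<pi>2)\<close>.\<close>

definition rho_bisimulation :: "('p, 'n) cat \<Rightarrow> ('o, 'm, 'p, 'n) func \<Rightarrow> ('p, 'n, 'p, 'n) func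
    \<Rightarrow> ('o \<Rightarrow> 'n) \<Rightarrow> 'o \<Rightarrow> 'm \<Rightarrow> 'o \<Rightarrow> 'm \<Rightarrow> 'm \<Rightarrow> 'm \<Rightarrow> 'n \<Rightarrow> 'n \<Rightarrow> bool" where
  "rho_bisimulation \<A> P L \<rho> X1 \<gamma>1 X2 \<gamma>2 \<pi>1 \<pi>2 \<pi>d1 \<pi>d2 \<longleftrightarrow>
     farr P \<pi>1 \<cdot>\<^bsub>\<A>\<^esub> complex_algebra \<A> P \<rho> X1 \<gamma>1 \<cdot>\<^bsub>\<A>\<^esub> farr L \<pi>d1 =
     farr P \<pi>2 \<cdot>\<^bsub>\<A>\<^esub> complex_algebra \<A> P \<rho> X2 \<gamma>2 \<cdot>\<^bsub>\<A>\<^esub> farr L \<pi>d2"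

definition lift_map :: "('o, 'm) cat \<Rightarrow> ('p, 'n) cat \<Rightarrow> ('o, 'm, 'p, 'n) func
    \<Rightarrow> ('p, 'n, 'o, 'm) func \<Rightarrow> ('o \<Rightarrow> 'p \<Rightarrow> 'm \<Rightarrow> 'n) \<Rightarrow> ('o, 'm, 'o, 'm) func
    \<Rightarrow> ('p, 'n, 'p, 'n) func \<Rightarrow> ('o \<Rightarrow> 'n) \<Rightarrow> 'o \<Rightarrow> 'n \<Rightarrow> 'm" where
  "lift_map \<C> \<A> P S \<phi> T L \<rho> X \<pi>d =
     farr S (farr L \<pi>d) \<cdot>\<^bsub>\<C>\<^esub> farr S (\<rho> X) \<cdot>\<^bsub>\<C>\<^esub> unit_C \<C> \<A> P S \<phi> (fobj T X)"

definition is_relation_lifting :: "('o, 'm) cat \<Rightarrow> ('p, 'n) cat \<Rightarrow> ('o, 'm, 'p, 'n) func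
    \<Rightarrow> ('p, 'n, 'o, 'm) func \<Rightarrow> ('o \<Rightarrow> 'p \<Rightarrow> 'm \<Rightarrow> 'n) \<Rightarrow> ('o, 'm, 'o, 'm) func
    \<Rightarrow> ('p, 'n, 'p, 'n) func \<Rightarrow> ('o \<Rightarrow> 'n) \<Rightarrow> 'o \<Rightarrow> 'o \<Rightarrow> 'n \<Rightarrow> 'n \<Rightarrow> 'o \<Rightarrow> 'm \<Rightarrow> 'm \<Rightarrow> bool" where
  "is_relation_lifting \<C> \<A> P S \<phi> T L \<rho> X1 X2 \<pi>d1 \<pi>d2 TB \<tau>1 \<tau>2 \<longleftrightarrow>
     is_pullback \<C> (lift_map \<C> \<A> P S \<phi> T L \<rho> X1 \<pi>d1) (lift_map \<C> \<A> P S \<phi> T L \<rho> X2 \<pi>d2) TB \<tau>1 \<tau>2"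

end

theory Submission
  imports Defs
begin

text \<open>The transpose of \<open>\<sigma>\<^sub>i\<close> under the dual adjunction is \<open>\<rho> X\<^sub>i \<circ> L \<pi>d\<^sub>i\<close>, so by naturality the
  transpose of \<open>\<sigma>\<^sub>i \<circ> \<gamma>\<^sub>i \<circ> \<pi>\<^sub>i\<close> is \<open>P \<pi>\<^sub>i \<circ> \<gamma>\<^sub>i\<^sup>* \<circ> L \<pi>d\<^sub>i\<close>. Transposition is injective, hence the
  \<open>\<rho>\<close>-bisimulation equation says exactly that \<open>(\<gamma>\<^sub>1 \<circ> \<pi>\<^sub>1, \<gamma>\<^sub>2 \<circ> \<pi>\<^sub>2)\<close> is a cone over the cospan
  whose pullback is the relation lifting.\<close>

lemma hom_Dom_Cod: "f \<in> hom C X Y \<Longrightarrow> f \<in> Arr C \<and> Dom C f = X \<and> Cod C f = Y"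
  by (simp add: hom_def)

lemma (in category) hom_objs: "f \<in> hom C X Y \<Longrightarrow> X \<in> Obj C \<and> Y \<in> Obj C"
  using Dom_in_Obj Cod_in_Obj by (auto simp: hom_def)

text \<open>Contravariant functors are encoded as functors on \<open>opp C\<close>. Through this
  equation their laws can be read as laws about arrows of \<open>C\<close> itself.\<close>

lemma hom_opp: "hom (opp C) X Y = hom C Y X"
  by (auto simp: hom_def opp_def)

lemma functor_obj: "is_functor C D F \<Longrightarrow> X \<in> Obj C \<Longrightarrow> fobj F X \<in> Obj D"
  by (simp add: is_functor_def)

lemma functor_hom:
  "is_functor C D F \<Longrightarrow> f \<in> hom C X Y \<Longrightarrow> farr F f \<in> hom D (fobj F X) (fobj F Y)"
  unfolding is_functor_def by blast

lemma contra_functor_obj: "is_contra_functor C D F \<Longrightarrow> X \<in> Obj C \<Longrightarrow> fobj F X \<in> Obj D"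
  using functor_obj[of "opp C"] by (simp add: is_contra_functor_def opp_def)

lemma contra_functor_hom:
  "is_contra_functor C D F \<Longrightarrow> f \<in> hom C X Y \<Longrightarrow> farr F f \<in> hom D (fobj F Y) (fobj F X)"
  using functor_hom[of "opp C"] by (simp add: is_contra_functor_def hom_opp)

lemma contra_functor_comp:
  assumes "is_contra_functor C D F" and "f \<in> hom C X Y" and "g \<in> hom C Y Z"
  shows "farr F (g \<cdot>\<^bsub>C\<^esub> f) = farr F f \<cdot>\<^bsub>D\<^esub> farr F g"
proof -
  \<comment> \<open>The functor law speaks of composition in \<open>opp C\<close>. Keeping
    \<open>Comp (opp C) f g\<close> folded lets \<open>blast\<close> match that law; the equation
    proved here then translates the argument of \<open>F\<close> back to \<open>C\<close>.\<close>
  have "Comp (opp C) f g = g \<cdot>\<^bsub>C\<^esub> f"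
    by (simp add: opp_def)
  moreover have "farr F (Comp (opp C) f g) = farr F f \<cdot>\<^bsub>D\<^esub> farr F g"
    using assms unfolding is_contra_functor_def is_functor_def hom_opp by blast
  ultimately show ?thesis by simp
qed

lemma logic_functor: "is_logic \<C> \<A> P T L \<rho> \<Longrightarrow> is_functor \<A> \<A> L"
  by (simp add: is_logic_def)

lemma logic_component:
  assumes "is_logic \<C> \<A> P T L \<rho>" and "X \<in> Obj \<C>"
  shows "\<rho> X \<in> hom \<A> (fobj L (fobj P X)) (fobj P (fobj T X))"
  using assms by (simp add: is_logic_def is_nat_trans_def func_comp_def opp_def)

text \<open>From left to right, \<open>f \<cdot> p = g \<cdot> q\<close> is composed with
  \<open>d\<close> and rebracketed; from right to left, the universal property supplies
  \<open>d\<close>. In this form the existence of \<delta> becomes a single equation between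
  composites.\<close>

lemma pullback_factor_iff:
  assumes "category C" and "is_pullback C f g Q p q"
    and "f \<in> hom C X W" and "g \<in> hom C Y W" and "u \<in> hom C Z X" and "v \<in> hom C Z Y"
  shows "(\<exists>d \<in> hom C Z Q. p \<cdot>\<^bsub>C\<^esub> d = u \<and> q \<cdot>\<^bsub>C\<^esub> d = v) \<longleftrightarrow> f \<cdot>\<^bsub>C\<^esub> u = g \<cdot>\<^bsub>C\<^esub> v"
proof -
  interpret category C by fact
  have D: "Dom C f = X" "Dom C g = Y"
    using assms(3,4) by (auto simp: hom_def)
  have p: "p \<in> hom C Q X" and q: "q \<in> hom C Q Y" and eq: "f \<cdot>\<^bsub>C\<^esub> p = g \<cdot>\<^bsub>C\<^esub> q"
    using assms(2) D by (auto simp: is_pullback_def)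
  show ?thesis
  proof
    assume "\<exists>d \<in> hom C Z Q. p \<cdot>\<^bsub>C\<^esub> d = u \<and> q \<cdot>\<^bsub>C\<^esub> d = v"
    then obtain d where d: "d \<in> hom C Z Q" "p \<cdot>\<^bsub>C\<^esub> d = u" "q \<cdot>\<^bsub>C\<^esub> d = v" by blast
    then show "f \<cdot>\<^bsub>C\<^esub> u = g \<cdot>\<^bsub>C\<^esub> v"
      using Comp_assoc[OF d(1) p assms(3)] Comp_assoc[OF d(1) q assms(4)] eq by simp
  next
    assume "f \<cdot>\<^bsub>C\<^esub> u = g \<cdot>\<^bsub>C\<^esub> v"
    then show "\<exists>d \<in> hom C Z Q. p \<cdot>\<^bsub>C\<^esub> d = u \<and> q \<cdot>\<^bsub>C\<^esub> d = v"
      using assms(2,5,6) D unfolding is_pullback_def by blast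
  qed
qed

text \<open>Only the adjunction is fixed here. The functor \<open>T\<close>, the logic and the
  coalgebra enter as hypotheses of the lemmas, each of which treats one leg of the span and is later
  instantiated for both.\<close>

locale dual_adj =
  \<C>: category \<C> + \<A>: category \<A>
  for \<C> :: "('o, 'm) cat" and \<A> :: "('p, 'n) cat" +
  fixes P :: "('o, 'm, 'p, 'n) func" and S :: "('p, 'n, 'o, 'm) func"
    and \<phi> :: "'o \<Rightarrow> 'p \<Rightarrow> 'm \<Rightarrow> 'n"
  assumes dual_adjunction: "dual_adjunction \<C> \<A> P S \<phi>"
begin

lemma contra_P: "is_contra_functor \<C> \<A> P" and contra_S: "is_contra_functor \<A> \<C> S"
  using dual_adjunction by (auto simp: dual_adjunction_def)

lemma bij_transpose:
  "X \<in> Obj \<C> \<Longrightarrow> A \<in> Obj \<A> \<Longrightarrow>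
    bij_betw (\<phi> X A) (hom \<C> X (fobj S A)) (hom \<A> A (fobj P X))"
  using dual_adjunction by (simp add: dual_adjunction_def)

lemma transpose_precomp:
  "A \<in> Obj \<A> \<Longrightarrow> h \<in> hom \<C> X' X \<Longrightarrow> f \<in> hom \<C> X (fobj S A) \<Longrightarrow>
    \<phi> X' A (f \<cdot>\<^bsub>\<C>\<^esub> h) = farr P h \<cdot>\<^bsub>\<A>\<^esub> \<phi> X A f"
  using dual_adjunction unfolding dual_adjunction_def by blast

lemma transpose_postcomp:
  "g \<in> hom \<A> A' A \<Longrightarrow> f \<in> hom \<C> X (fobj S A) \<Longrightarrow>
    \<phi> X A' (farr S g \<cdot>\<^bsub>\<C>\<^esub> f) = \<phi> X A f \<cdot>\<^bsub>\<A>\<^esub> g"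
  using dual_adjunction \<C>.hom_objs[of f] unfolding dual_adjunction_def by blast

text \<open>Transposition is surjective, so the identity of \<open>P X\<close> lies in its image.
  Hence \<open>inv_into\<close> in \<open>unit_C\<close> picks a genuine preimage, which gives both
  claims at once.\<close>

lemma
  assumes "X \<in> Obj \<C>"
  shows unit_C_hom: "unit_C \<C> \<A> P S \<phi> X \<in> hom \<C> X (fobj S (fobj P X))"
    and transpose_unit_C: "\<phi> X (fobj P X) (unit_C \<C> \<A> P S \<phi> X) = Ident \<A> (fobj P X)"
proof -
  have PX: "fobj P X \<in> Obj \<A>"
    using contra_functor_obj[OF contra_P assms] .
  have "Ident \<A> (fobj P X) \<in> \<phi> X (fobj P X) ` hom \<C> X (fobj S (fobj P X))"
    using bij_transpose[OF assms PX] \<A>.Ident_in_hom[OF PX] by (simp add: bij_betw_def)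
  then show "unit_C \<C> \<A> P S \<phi> X \<in> hom \<C> X (fobj S (fobj P X))"
    and "\<phi> X (fobj P X) (unit_C \<C> \<A> P S \<phi> X) = Ident \<A> (fobj P X)"
    unfolding unit_C_def by (rule inv_into_into, rule f_inv_into_f)
qed

text \<open>Naturality in the algebra argument turns postcomposition with \<open>S g\<close> into
  precomposition with \<open>g\<close>. Applied first to \<open>S (L \<pi>d)\<close> and then to
  \<open>S (\<rho> X)\<close>, it leaves the transpose of the unit, which is an identity and is
  absorbed by \<open>\<rho> X\<close>.\<close>

lemma
  assumes T: "is_functor \<C> \<C> T" and logic: "is_logic \<C> \<A> P T L \<rho>"
    and X: "X \<in> Obj \<C>" and \<pi>d: "\<pi>d \<in> hom \<A> A (fobj P X)"
  shows lift_map_hom: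
      "lift_map \<C> \<A> P S \<phi> T L \<rho> X \<pi>d \<in> hom \<C> (fobj T X) (fobj S (fobj L A))"
    and transpose_lift_map:
      "\<phi> (fobj T X) (fobj L A) (lift_map \<C> \<A> P S \<phi> T L \<rho> X \<pi>d) = \<rho> X \<cdot>\<^bsub>\<A>\<^esub> farr L \<pi>d"
proof -
  let ?\<eta> = "unit_C \<C> \<A> P S \<phi> (fobj T X)"
  have TX: "fobj T X \<in> Obj \<C>"
    using functor_obj[OF T X] .
  note \<eta> = unit_C_hom[OF TX]
  note \<rho> = logic_component[OF logic X]
  have L\<pi>d: "farr L \<pi>d \<in> hom \<A> (fobj L A) (fobj L (fobj P X))"
    using functor_hom[OF logic_functor[OF logic] \<pi>d] .
  have S\<rho>\<eta>: "farr S (\<rho> X) \<cdot>\<^bsub>\<C>\<^esub> ?\<eta> \<in> hom \<C> (fobj T X) (fobj S (fobj L (fobj P X)))"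
    using \<C>.Comp_in_hom[OF \<eta> contra_functor_hom[OF contra_S \<rho>]] .
  show "lift_map \<C> \<A> P S \<phi> T L \<rho> X \<pi>d \<in> hom \<C> (fobj T X) (fobj S (fobj L A))"
    unfolding lift_map_def
    using \<C>.Comp_in_hom[OF S\<rho>\<eta> contra_functor_hom[OF contra_S L\<pi>d]] .
  show "\<phi> (fobj T X) (fobj L A) (lift_map \<C> \<A> P S \<phi> T L \<rho> X \<pi>d) = \<rho> X \<cdot>\<^bsub>\<A>\<^esub> farr L \<pi>d"
    unfolding lift_map_def transpose_postcomp[OF L\<pi>d S\<rho>\<eta>] transpose_postcomp[OF \<rho> \<eta>]
      transpose_unit_C[OF TX] \<A>.Ident_left[OF \<rho>] ..
qed

lemma transpose_lift_map_coalgebra: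
  assumes T: "is_functor \<C> \<C> T" and logic: "is_logic \<C> \<A> P T L \<rho>"
    and \<gamma>: "is_coalgebra \<C> T X \<gamma>" and \<pi>: "\<pi> \<in> hom \<C> B X"
    and \<pi>d: "\<pi>d \<in> hom \<A> A (fobj P X)"
  shows "\<phi> B (fobj L A) (lift_map \<C> \<A> P S \<phi> T L \<rho> X \<pi>d \<cdot>\<^bsub>\<C>\<^esub> \<gamma> \<cdot>\<^bsub>\<C>\<^esub> \<pi>) =
    farr P \<pi> \<cdot>\<^bsub>\<A>\<^esub> complex_algebra \<A> P \<rho> X \<gamma> \<cdot>\<^bsub>\<A>\<^esub> farr L \<pi>d"
proof -
  have X: "X \<in> Obj \<C>" and \<gamma>_hom: "\<gamma> \<in> hom \<C> X (fobj T X)"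
    using \<gamma> by (auto simp: is_coalgebra_def)
  note \<sigma> = lift_map_hom[OF T logic X \<pi>d]
  note \<rho> = logic_component[OF logic X]
  note L = logic_functor[OF logic]
  note L\<pi>d = functor_hom[OF L \<pi>d]
  have LA: "fobj L A \<in> Obj \<A>"
    using \<A>.hom_objs[OF L\<pi>d] by simp
  note P\<gamma> = contra_functor_hom[OF contra_P \<gamma>_hom] and P\<pi> = contra_functor_hom[OF contra_P \<pi>]
  \<comment> \<open>Composition associates to the right, so \<open>\<gamma> \<cdot> \<pi>\<close> is
    already a single arrow \<open>B \<rightarrow> T X\<close>, and naturality in the coalgebra
    argument moves it out as \<open>P (\<gamma> \<cdot> \<pi>)\<close>.\<close>
  have "\<phi> B (fobj L A) (lift_map \<C> \<A> P S \<phi> T L \<rho> X \<pi>d \<cdot>\<^bsub>\<C>\<^esub> \<gamma> \<cdot>\<^bsub>\<C>\<^esub> \<pi>) =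
      farr P (\<gamma> \<cdot>\<^bsub>\<C>\<^esub> \<pi>) \<cdot>\<^bsub>\<A>\<^esub> \<rho> X \<cdot>\<^bsub>\<A>\<^esub> farr L \<pi>d"
    using transpose_precomp[OF LA \<C>.Comp_in_hom[OF \<pi> \<gamma>_hom] \<sigma>]
      transpose_lift_map[OF T logic X \<pi>d] by simp
  \<comment> \<open>Contravariance splits \<open>P (\<gamma> \<cdot> \<pi>)\<close> in reverse
    order; this places \<open>P \<gamma>\<close> next to \<open>\<rho> X\<close>, where the two form
    the complex algebra.\<close>
  also have "\<dots> = farr P \<pi> \<cdot>\<^bsub>\<A>\<^esub> farr P \<gamma> \<cdot>\<^bsub>\<A>\<^esub> \<rho> X \<cdot>\<^bsub>\<A>\<^esub> farr L \<pi>d"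
    using contra_functor_comp[OF contra_P \<pi> \<gamma>_hom]
      \<A>.Comp_assoc[OF \<A>.Comp_in_hom[OF L\<pi>d \<rho>] P\<gamma> P\<pi>] by simp
  also have "\<dots> = farr P \<pi> \<cdot>\<^bsub>\<A>\<^esub> complex_algebra \<A> P \<rho> X \<gamma> \<cdot>\<^bsub>\<A>\<^esub> farr L \<pi>d"
    unfolding complex_algebra_def using \<A>.Comp_assoc[OF L\<pi>d \<rho> P\<gamma>] by simp
  finally show ?thesis .
qed

end

theorem theorem3p17:
  fixes \<C> :: "('o, 'm) cat" and \<A> :: "('p, 'n) cat"
    and P :: "('o, 'm, 'p, 'n) func" and S :: "('p, 'n, 'o, 'm) func"
    and \<phi> :: "'o \<Rightarrow> 'p \<Rightarrow> 'm \<Rightarrow> 'n"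
    and T :: "('o, 'm, 'o, 'm) func" and L :: "('p, 'n, 'p, 'n) func" and \<rho> :: "'o \<Rightarrow> 'n"
    and \<E> :: "'m set"
    and X1 X2 B TB :: 'o and \<gamma>1 \<gamma>2 \<pi>1 \<pi>2 \<tau>1 \<tau>2 :: 'm
    and Bd :: 'p and \<pi>d1 \<pi>d2 :: 'n
  assumes "category \<C>" and "category \<A>"
    and "dual_adjunction \<C> \<A> P S \<phi>"
    and "is_functor \<C> \<C> T"
    and "is_logic \<C> \<A> P T L \<rho>"
    and "finitely_complete \<C>"
    and "well_powered TYPE('s) \<C>"
    and "factorisation_system \<C> \<E> {m. is_mono \<C> m}"
    and "has_pullbacks \<A> \<or> has_pushouts \<C>"
    and "is_coalgebra \<C> T X1 \<gamma>1" and "is_coalgebra \<C> T X2 \<gamma>2"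
    and "\<pi>1 \<in> hom \<C> B X1" and "\<pi>2 \<in> hom \<C> B X2" and "jointly_mono \<C> B \<pi>1 \<pi>2"
    and "is_dual_span \<A> P \<pi>1 \<pi>2 Bd \<pi>d1 \<pi>d2"
    and "is_relation_lifting \<C> \<A> P S \<phi> T L \<rho> X1 X2 \<pi>d1 \<pi>d2 TB \<tau>1 \<tau>2"
  shows "rho_bisimulation \<A> P L \<rho> X1 \<gamma>1 X2 \<gamma>2 \<pi>1 \<pi>2 \<pi>d1 \<pi>d2 \<longleftrightarrow>
    (\<exists>\<delta> \<in> hom \<C> B TB. \<tau>1 \<cdot>\<^bsub>\<C>\<^esub> \<delta> = \<gamma>1 \<cdot>\<^bsub>\<C>\<^esub> \<pi>1 \<and> \<tau>2 \<cdot>\<^bsub>\<C>\<^esub> \<delta> = \<gamma>2 \<cdot>\<^bsub>\<C>\<^esub> \<pi>2)"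
proof -
  interpret dual_adj \<C> \<A> P S \<phi>
    using assms(1-3) by (simp add: dual_adj_def dual_adj_axioms_def)
  note T = assms(4) and logic = assms(5) and \<gamma>1 = assms(10) and \<gamma>2 = assms(11)
    and \<pi>1 = assms(12) and \<pi>2 = assms(13)
  have X: "X1 \<in> Obj \<C>" "X2 \<in> Obj \<C>"
    and \<gamma>_hom: "\<gamma>1 \<in> hom \<C> X1 (fobj T X1)" "\<gamma>2 \<in> hom \<C> X2 (fobj T X2)"
    using \<gamma>1 \<gamma>2 by (auto simp: is_coalgebra_def)
  \<comment> \<open>The pullback types its legs by the domains of \<open>P \<pi>1\<close> and
    \<open>P \<pi>2\<close>; since \<open>P\<close> reverses arrows, these are \<open>P X1\<close>
    and \<open>P X2\<close>.\<close>
  have \<pi>d: "\<pi>d1 \<in> hom \<A> Bd (fobj P X1)" "\<pi>d2 \<in> hom \<A> Bd (fobj P X2)"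
    using assms(15) hom_Dom_Cod[OF contra_functor_hom[OF contra_P \<pi>1]]
      hom_Dom_Cod[OF contra_functor_hom[OF contra_P \<pi>2]]
    by (auto simp: is_dual_span_def is_pullback_def)
  let ?\<sigma>1 = "lift_map \<C> \<A> P S \<phi> T L \<rho> X1 \<pi>d1" and ?\<sigma>2 = "lift_map \<C> \<A> P S \<phi> T L \<rho> X2 \<pi>d2"
  note \<sigma>1 = lift_map_hom[OF T logic X(1) \<pi>d(1)] and \<sigma>2 = lift_map_hom[OF T logic X(2) \<pi>d(2)]
  note \<gamma>\<pi>1 = \<C>.Comp_in_hom[OF \<pi>1 \<gamma>_hom(1)] and \<gamma>\<pi>2 = \<C>.Comp_in_hom[OF \<pi>2 \<gamma>_hom(2)]
  note L = logic_functor[OF logic]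
  have B: "B \<in> Obj \<C>" and LBd: "fobj L Bd \<in> Obj \<A>"
    using \<C>.hom_objs[OF \<pi>1] functor_obj[OF L] \<A>.hom_objs[OF \<pi>d(1)] by auto
  have "rho_bisimulation \<A> P L \<rho> X1 \<gamma>1 X2 \<gamma>2 \<pi>1 \<pi>2 \<pi>d1 \<pi>d2 \<longleftrightarrow>
      \<phi> B (fobj L Bd) (?\<sigma>1 \<cdot>\<^bsub>\<C>\<^esub> \<gamma>1 \<cdot>\<^bsub>\<C>\<^esub> \<pi>1) = \<phi> B (fobj L Bd) (?\<sigma>2 \<cdot>\<^bsub>\<C>\<^esub> \<gamma>2 \<cdot>\<^bsub>\<C>\<^esub> \<pi>2)"
    unfolding rho_bisimulation_def transpose_lift_map_coalgebra[OF T logic \<gamma>1 \<pi>1 \<pi>d(1)]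
      transpose_lift_map_coalgebra[OF T logic \<gamma>2 \<pi>2 \<pi>d(2)] ..
  \<comment> \<open>Both composites lie in the same hom-set from \<open>B\<close> to
    \<open>S (L Bd)\<close>, on which transposition is injective.\<close>
  also have "\<dots> \<longleftrightarrow> ?\<sigma>1 \<cdot>\<^bsub>\<C>\<^esub> \<gamma>1 \<cdot>\<^bsub>\<C>\<^esub> \<pi>1 = ?\<sigma>2 \<cdot>\<^bsub>\<C>\<^esub> \<gamma>2 \<cdot>\<^bsub>\<C>\<^esub> \<pi>2"
    using inj_on_eq_iff[OF bij_betw_imp_inj_on[OF bij_transpose[OF B LBd]]
        \<C>.Comp_in_hom[OF \<gamma>\<pi>1 \<sigma>1] \<C>.Comp_in_hom[OF \<gamma>\<pi>2 \<sigma>2]] .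
  also have "\<dots> \<longleftrightarrow>
      (\<exists>\<delta> \<in> hom \<C> B TB. \<tau>1 \<cdot>\<^bsub>\<C>\<^esub> \<delta> = \<gamma>1 \<cdot>\<^bsub>\<C>\<^esub> \<pi>1 \<and> \<tau>2 \<cdot>\<^bsub>\<C>\<^esub> \<delta> = \<gamma>2 \<cdot>\<^bsub>\<C>\<^esub> \<pi>2)"
    \<comment> \<open>The relation lifting is the pullback of \<open>?\<sigma>1\<close> and
      \<open>?\<sigma>2\<close>, tested here on the pair \<open>\<gamma>1 \<cdot> \<pi>1\<close>,
      \<open>\<gamma>2 \<cdot> \<pi>2\<close>; the mediating arrow is \<delta>.\<close>
    using pullback_factor_iff[OF \<C>.category_axioms assms(16)[unfolded is_relation_lifting_def]
        \<sigma>1 \<sigma>2 \<gamma>\<pi>1 \<gamma>\<pi>2] ..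
  finally show ?thesis .
qed

end
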